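(* Fix $T>0$, real constants $A_F,B_F,A_L,B_L$ with $B_F\neq0$, constants $\sigma_F,\sigma_L,Q_F,R_F,Q_L,R_L,Q_{L,T}>0$, $\lambda_L\ge0$, and a continuous $F:[0,T]\to\mathbb{R}$. Let $a$ solve $\dot a_t=\tfrac{2B_F^2}{R_F}a_t^2-2A_Fa_t-\tfrac{Q_F}{2}$, $a_T=0$, put $f(t):=A_F-\tfrac{2B_F^2}{R_F}a_t$, $h(t):=Q_Fe^{\int_0^tf(u)\,\mathrm du}$, $k(t):=e^{-2\int_0^tf(u)\,\mathrm du}$, $c:=\tfrac{B_F^4\lambda_L}{\sigma_F^2R_F^2}$, $e_1=(1,0,0)^{\mathsf T}$, and $$\mathcal A(t)=\begin{bmatrix}A_L&0&0\\-h(t)&0&0\\0&k(t)&0\end{bmatrix},\ \mathcal B=B_Le_1,\ \mathcal Q(t)=\mathrm{diag}\Big\{\tfrac{Q_L}2,-c\,k(t),0\Big\},\ L_T=\begin{bmatrix}\tfrac{Q_{L,T}}2&0&0\\0&-c\int_0^Tk(s)\,\mathrm ds&c\\0&c&0\end{bmatrix},\ M_T=-Q_{L,T}F(T)e_1.$$ Consider the system $$\dot L_t+L_t\mathcal A(t)+\mathcal A(t)^{\mathsf T}L_t-\tfrac2{R_L}L_t\mathcal B\mathcal B^{\mathsf T}L_t+\mathcal Q(t)=0,\qquad \dot M_t+\mathcal A(t)^{\mathsf T}M_t-\tfrac2{R_L}L_t\mathcal B\mathcal B^{\mathsf T}M_t-Q_LF(t)e_1=0$$ for $L_t\in\mathbb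 S^{3\times3}$, $M_t\in\mathbb{R}^3$ with terminal values $L_T,M_T$. Define $$q:=\max\Big\{\Big|\tfrac{Q_L}2-|A_L|-\|h\|_\infty\Big|,\ (c+1)\|k\|_\infty\Big\},\quad \beta:=\max\Big\{\tfrac{2}{R_L}B_L^2+|A_L|,\ \|h\|_\infty,\ \|k\|_\infty\Big\},\quad y_0:=\max\Big\{\tfrac{Q_{L,T}}2,\ c(\|k\|_1+1)\Big\}.$$ If $$T<\frac1{\sqrt{\beta q}}\arctan\Big(\sqrt{\tfrac q\beta}\,\frac1{y_0}\Big),$$ then the system admits a unique solution on $[0,T]$.
   Context: $\|\cdot\|_\infty$ and $\|\cdot\|_1$ denote the sup norm and $L^1$ norm of functions on $[0,T]$. $\mathbb S^{3\times3}$ denotes symmetric $3\times3$ real matrices. *)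

theory Defs
  imports "HOL-Analysis.Analysis"
begin

definition outer :: "real^'n \<Rightarrow> real^'n \<Rightarrow> real^'n^'n" where
  "outer u v = (\<chi> i j. u $ i * v $ j)"

definition supnorm :: "real \<Rightarrow> (real \<Rightarrow> real) \<Rightarrow> real" where
  "supnorm T g = (SUP t\<in>{0..T}. \<bar>g t\<bar>)"

definition l1norm :: "real \<Rightarrow> (real \<Rightarrow> real) \<Rightarrow> real" where
  "l1norm T g = integral {0..T} (\<lambda>t. \<bar>g t\<bar>)"

definition f_fun :: "real \<Rightarrow> real \<Rightarrow> real \<Rightarrow> (real \<Rightarrow> real) \<Rightarrow> real \<Rightarrow> real" where
  "f_fun A_F B_F R_F a t = A_F - 2 * B_F\<^sup>2 / R_F * a t"

definition h_fun :: "real \<Rightarrow> real \<Rightarrow> real \<Rightarrow> real \<Rightarrow> (real \<Rightarrow> real) \<Rightarrow> real \<Rightarrow> real" where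
  "h_fun Q_F A_F B_F R_F a t = Q_F * exp (integral {0..t} (f_fun A_F B_F R_F a))"

definition k_fun :: "real \<Rightarrow> real \<Rightarrow> real \<Rightarrow> (real \<Rightarrow> real) \<Rightarrow> real \<Rightarrow> real" where
  "k_fun A_F B_F R_F a t = exp (- 2 * integral {0..t} (f_fun A_F B_F R_F a))"

definition e1 :: "real^3" where
  "e1 = vector [1, 0, 0]"

definition calA :: "real \<Rightarrow> (real \<Rightarrow> real) \<Rightarrow> (real \<Rightarrow> real) \<Rightarrow> real \<Rightarrow> real^3^3" where
  "calA A_L h k t = vector [vector [A_L, 0, 0], vector [- h t, 0, 0], vector [0, k t, 0]]"

definition calQ :: "real \<Rightarrow> real \<Rightarrow> (real \<Rightarrow> real) \<Rightarrow> real \<Rightarrow> real^3^3" where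
  "calQ Q_L c k t = vector [vector [Q_L / 2, 0, 0], vector [0, - c * k t, 0], vector [0, 0, 0]]"

definition L_term :: "real \<Rightarrow> real \<Rightarrow> real \<Rightarrow> (real \<Rightarrow> real) \<Rightarrow> real^3^3" where
  "L_term T Q_LT c k = vector [vector [Q_LT / 2, 0, 0], vector [0, - c * integral {0..T} k, c], vector [0, c, 0]]"

definition is_sol :: "real \<Rightarrow> (real \<Rightarrow> real^3^3) \<Rightarrow> real^3 \<Rightarrow> real \<Rightarrow> (real \<Rightarrow> real^3^3)
    \<Rightarrow> (real \<Rightarrow> real^3) \<Rightarrow> real^3^3 \<Rightarrow> real^3
    \<Rightarrow> (real \<Rightarrow> real^3^3) \<Rightarrow> (real \<Rightarrow> real^3) \<Rightarrow> bool" where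
  "is_sol T \<A> \<B> R_L \<Q> G L_T M_T L M \<longleftrightarrow>
     (\<forall>t\<in>{0..T}. transpose (L t) = L t) \<and>
     (\<forall>t\<in>{0..T}. (L has_vector_derivative
         (- (L t ** \<A> t + transpose (\<A> t) ** L t
             - (2 / R_L) *\<^sub>R (L t ** outer \<B> \<B> ** L t) + \<Q> t))) (at t within {0..T})) \<and>
     (\<forall>t\<in>{0..T}. (M has_vector_derivative
         (- (transpose (\<A> t) *v M t - (2 / R_L) *\<^sub>R ((L t ** outer \<B> \<B>) *v M t) - G t)))
         (at t within {0..T})) \<and>
     L T = L_T \<and> M T = M_T"

end

theory Submission
  imports Defs
begin

text \<open>The matrix equation is linearised by \<open>L = Y X\<^sup>-\<^sup>1\<close>, where \<open>(X, Y)\<close> solves the linear Hamiltonian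
  system with \<open>X T = I\<close>, \<open>Y T = L_T\<close>; the equation for \<open>M\<close> is linear once \<open>L\<close> is known, and
  uniqueness follows from the linear equation satisfied by the difference of two solutions. What remains
  is the invertibility of \<open>X\<close>, that is, the absence of conjugate points. If \<open>X t0\<close> were singular there
  would be a nonzero extremal \<open>(x, y)\<close> with \<open>x t0 = 0\<close> and zero cost. Along an extremal the indefinite
  part of the cost is \<open>- c \<integral> k (x2 T - x2)\<^sup>2\<close>. Two multipliers of the form
  \<open>sqrt (q / \<beta>) tan (sqrt (\<beta> q) s)\<close>, i.e. solutions of the comparison equation \<open>y' = \<beta> y\<^sup>2 + q\<close>,
  bound the control cost from below by \<open>(\<parallel>h\<parallel> - Q_L / 2) \<integral> x1\<^sup>2\<close> and the indefinite part from below
  by \<open>- c / (c + 1) \<parallel>h\<parallel> \<integral> x1\<^sup>2\<close>. Hence the cost is at least \<open>\<parallel>h\<parallel> / (c + 1) \<integral> x1\<^sup>2\<close>, which forces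
  \<open>x = 0\<close>.\<close>

section \<open>Linear ordinary differential equations\<close>

lemma has_real_derivative_nonneg_imp_le:
  fixes f :: "real \<Rightarrow> real"
  assumes "a \<le> b"
    and der: "\<And>t. t \<in> {a..b} \<Longrightarrow> (f has_real_derivative f' t) (at t within {a..b})"
    and nonneg: "\<And>t. t \<in> {a..b} \<Longrightarrow> 0 \<le> f' t"
  shows "f a \<le> f b"
proof (rule DERIV_nonneg_imp_increasing_open[OF \<open>a \<le> b\<close>])
  show "\<exists>y. DERIV f t :> y \<and> 0 \<le> y" if "a < t" "t < b" for t
    using der[of t] nonneg[of t] that at_within_Icc_at[of a t b] by auto
  show "continuous_on {a..b} f"
    by (rule DERIV_continuous_on) (rule der)
qed

text \<open>Expanding the argument in the finite basis writes \<open>\<Phi> t (u t)\<close> as a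
  finite sum of continuous scalars times the curves \<open>\<Phi> t b\<close>. Pointwise continuity
  of the family therefore gives continuity along a moving argument.\<close>

lemma linear_family_apply_continuous:
  fixes \<Phi> :: "real \<Rightarrow> 'a::euclidean_space \<Rightarrow> 'b::real_normed_vector"
  assumes lin: "\<And>t. t \<in> S \<Longrightarrow> linear (\<Phi> t)"
    and cont: "\<And>v. continuous_on S (\<lambda>t. \<Phi> t v)"
    and u: "continuous_on S u"
  shows "continuous_on S (\<lambda>t. \<Phi> t (u t))"
proof -
  have "\<Phi> t (u t) = (\<Sum>b\<in>Basis. (u t \<bullet> b) *\<^sub>R \<Phi> t b)" if "t \<in> S" for t
  proof -
    have "\<Phi> t (u t) = \<Phi> t (\<Sum>b\<in>Basis. (u t \<bullet> b) *\<^sub>R b)"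
      by (simp add: euclidean_representation)
    then show ?thesis
      by (simp add: linear_sum[OF lin[OF that]] linear_cmul[OF lin[OF that]])
  qed
  moreover have "continuous_on S (\<lambda>t. \<Sum>b\<in>Basis. (u t \<bullet> b) *\<^sub>R \<Phi> t b)"
    by (intro continuous_intros u cont)
  ultimately show ?thesis
    by (simp cong: continuous_on_cong)
qed

text \<open>Compactness bounds each curve \<open>\<Phi> t b\<close>; finitely many basis vectors
  then yield one constant for all \<open>t\<close> and \<open>v\<close>. The summand 1 in
  \<open>K\<close> makes it strictly positive.\<close>

lemma linear_family_bounded:
  fixes \<Phi> :: "real \<Rightarrow> 'a::euclidean_space \<Rightarrow> 'b::real_normed_vector"
  assumes lin: "\<And>t. t \<in> {a..b} \<Longrightarrow> linear (\<Phi> t)"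
    and cont: "\<And>v. continuous_on {a..b} (\<lambda>t. \<Phi> t v)"
  obtains K where "0 < K" "\<And>t v. t \<in> {a..b} \<Longrightarrow> norm (\<Phi> t v) \<le> K * norm v"
proof -
  have "bounded ((\<lambda>t. \<Phi> t v) ` {a..b})" for v
    using compact_continuous_image[OF cont] compact_imp_bounded by blast
  then have "\<exists>C. \<forall>t\<in>{a..b}. norm (\<Phi> t v) \<le> C" for v
    by (auto simp: bounded_iff)
  then obtain C where C: "\<And>v t. t \<in> {a..b} \<Longrightarrow> norm (\<Phi> t v) \<le> C v"
    by metis
  define K where "K = 1 + (\<Sum>b\<in>Basis. \<bar>C b\<bar>)"
  have "norm (\<Phi> t v) \<le> K * norm v" if t: "t \<in> {a..b}" for t v
  proof -
    have "\<Phi> t v = \<Phi> t (\<Sum>b\<in>Basis. (v \<bullet> b) *\<^sub>R b)"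
      by (simp add: euclidean_representation)
    also have "\<dots> = (\<Sum>b\<in>Basis. (v \<bullet> b) *\<^sub>R \<Phi> t b)"
      by (simp add: linear_sum[OF lin[OF t]] linear_cmul[OF lin[OF t]])
    also have "norm \<dots> \<le> (\<Sum>b\<in>Basis. norm v * \<bar>C b\<bar>)"
    proof (rule sum_norm_le)
      fix b :: 'a assume b: "b \<in> Basis"
      show "norm ((v \<bullet> b) *\<^sub>R \<Phi> t b) \<le> norm v * \<bar>C b\<bar>"
        using Basis_le_norm[OF b, of v] C[OF t, of b]
        by (auto intro!: mult_mono)
    qed
    also have "\<dots> \<le> K * norm v"
      by (simp add: K_def sum_distrib_left[symmetric] algebra_simps)
    finally show ?thesis .
  qed
  moreover have "0 < K"
    by (simp add: K_def add_pos_nonneg sum_nonneg)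
  ultimately show ?thesis using that by blast
qed

text \<open>A Gronwall argument run backwards from \<open>b\<close>: by Cauchy-Schwarz the squared
  norm decays at rate at most \<open>2 * K\<close>, so the weight \<open>exp (2 * K * s)\<close>
  makes it nondecreasing. It vanishes at \<open>b\<close>, hence everywhere before.\<close>

lemma linear_ode_zero_terminal:
  fixes x :: "real \<Rightarrow> 'a::euclidean_space"
  assumes lin: "\<And>t. t \<in> {a..b} \<Longrightarrow> linear (\<Phi> t)"
    and cont: "\<And>v. continuous_on {a..b} (\<lambda>t. \<Phi> t v)"
    and der: "\<And>t. t \<in> {a..b} \<Longrightarrow> (x has_vector_derivative \<Phi> t (x t)) (at t within {a..b})"
    and "x b = 0" and t: "t \<in> {a..b}"
  shows "x t = 0"
proof -
  obtain K where "0 < K" and K: "\<And>t v. t \<in> {a..b} \<Longrightarrow> norm (\<Phi> t v) \<le> K * norm v"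
    using linear_family_bounded[OF lin cont] by blast
  define E where "E = (\<lambda>s. exp (2 * K * s) * (x s \<bullet> x s))"
  have "E t \<le> E b"
  proof (rule has_real_derivative_nonneg_imp_le[where f = E and
        f' = "\<lambda>s. exp (2 * K * s) * (2 * K * (x s \<bullet> x s) + 2 * (x s \<bullet> \<Phi> s (x s)))"])
    fix s assume s: "s \<in> {t..b}"
    then have sab: "s \<in> {a..b}" using t by auto
    have xd: "(x has_vector_derivative \<Phi> s (x s)) (at s within {t..b})"
      by (rule has_vector_derivative_within_subset[OF der[OF sab]]) (use t in auto)
    have "((\<lambda>s. x s \<bullet> x s) has_vector_derivative (x s \<bullet> \<Phi> s (x s) + \<Phi> s (x s) \<bullet> x s)) (at s within {t..b})"
      by (rule bounded_bilinear.has_vector_derivative[OF bounded_bilinear_inner xd xd])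
    then have "((\<lambda>s. x s \<bullet> x s) has_real_derivative (2 * (x s \<bullet> \<Phi> s (x s)))) (at s within {t..b})"
      by (simp add: has_real_derivative_iff_has_vector_derivative inner_commute)
    then show "(E has_real_derivative
        exp (2 * K * s) * (2 * K * (x s \<bullet> x s) + 2 * (x s \<bullet> \<Phi> s (x s)))) (at s within {t..b})"
      unfolding E_def by (auto intro!: derivative_eq_intros simp: algebra_simps)
    have "- (x s \<bullet> \<Phi> s (x s)) \<le> norm (x s) * norm (\<Phi> s (x s))"
      using Cauchy_Schwarz_ineq2[of "x s" "\<Phi> s (x s)"] by linarith
    also have "\<dots> \<le> norm (x s) * (K * norm (x s))"
      by (intro mult_left_mono K sab) auto
    also have "\<dots> = K * (x s \<bullet> x s)"
      by (simp add: dot_square_norm power2_eq_square)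
    finally show "0 \<le> exp (2 * K * s) * (2 * K * (x s \<bullet> x s) + 2 * (x s \<bullet> \<Phi> s (x s)))"
      by simp
  qed (use t in auto)
  then have "x t \<bullet> x t \<le> 0"
    using \<open>x b = 0\<close> by (simp add: E_def mult_le_0_iff not_le)
  then show ?thesis
    by (metis inner_eq_zero_iff inner_ge_zero order_antisym)
qed

text \<open>With \<open>x t = exp (\<lambda> (t - a)) u t\<close> and \<open>\<lambda> = 2 K\<close> the Picard operator acting on \<open>u\<close> is a
  contraction on the whole interval, so no gluing of local solutions is needed.\<close>

lemma linear_ode_initial_exists:
  fixes \<Phi> :: "real \<Rightarrow> 'a::euclidean_space \<Rightarrow> 'a"
  assumes "a \<le> b"
    and lin: "\<And>t. t \<in> {a..b} \<Longrightarrow> linear (\<Phi> t)"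
    and cont: "\<And>v. continuous_on {a..b} (\<lambda>t. \<Phi> t v)"
    and g: "continuous_on {a..b} g"
  obtains x where "x a = x0"
    "\<And>t. t \<in> {a..b} \<Longrightarrow> (x has_vector_derivative \<Phi> t (x t) + g t) (at t within {a..b})"
proof -
  obtain K where "0 < K" and K: "\<And>t v. t \<in> {a..b} \<Longrightarrow> norm (\<Phi> t v) \<le> K * norm v"
    using linear_family_bounded[OF lin cont] by blast
  define E where "E = (\<lambda>s. exp (2 * K * (s - a)))"
  have E_cont: "continuous_on S E" for S
    unfolding E_def by (intro continuous_intros)
  have E_pos: "0 < E s" for s by (simp add: E_def)
  define r where "r = (\<lambda>u s. \<Phi> s (E s *\<^sub>R u s) + g s)"
  define I where "I = (\<lambda>u t. x0 + integral {a..t} (r u))"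
  have r_cont: "continuous_on {a..b} (r u)" if "continuous_on {a..b} u" for u
    unfolding r_def
    by (intro continuous_intros g linear_family_apply_continuous[OF lin cont] E_cont that)
  have I_der: "(I u has_vector_derivative r u t) (at t within {a..b})"
    if "continuous_on {a..b} u" "t \<in> {a..b}" for u t
    unfolding I_def
    by (auto intro!: derivative_eq_intros integral_has_vector_derivative r_cont that)
  have I_cont: "continuous_on {a..b} (I u)" if "continuous_on {a..b} u" for u
    by (rule continuous_on_vector_derivative[OF I_der[OF that]])
  \<comment> \<open>The fixed point is sought in the complete space of bounded continuous functions
    on the whole line. Composing with \<open>clamp\<close> freezes the values outside
    \<open>{a..b}\<close> and makes the rescaled Picard image such a function.\<close>
  have "\<exists>G::real \<Rightarrow>\<^sub>C 'a. \<forall>t. G t = (1 / E (clamp a b t)) *\<^sub>R I u (clamp a b t)"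
    if "continuous_on {a..b} u" for u
  proof -
    have "continuous_on (cbox a b) (\<lambda>t. (1 / E t) *\<^sub>R I u t)"
    proof (intro continuous_intros E_cont)
      show "\<forall>t\<in>cbox a b. E t \<noteq> 0"
        by (simp add: E_def)
      show "continuous_on (cbox a b) (I u)"
        using I_cont[OF that] by simp
    qed
    then obtain G :: "real \<Rightarrow>\<^sub>C 'a" where "\<And>t. G t = (1 / E (clamp a b t)) *\<^sub>R I u (clamp a b t)"
      by (rule continuous_on_cbox_bcontfunE) blast
    then show ?thesis by blast
  qed
  then have "\<forall>u::real \<Rightarrow>\<^sub>C 'a. \<exists>G::real \<Rightarrow>\<^sub>C 'a. \<forall>t. G t = (1 / E (clamp a b t)) *\<^sub>R I u (clamp a b t)"
    by simp
  then obtain P :: "(real \<Rightarrow>\<^sub>C 'a) \<Rightarrow> (real \<Rightarrow>\<^sub>C 'a)"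
    where P: "\<And>u t. P u t = (1 / E (clamp a b t)) *\<^sub>R I u (clamp a b t)"
    by metis
  have contraction: "dist (P u) (P v) \<le> 1 / 2 * dist u v" for u v
  proof (rule dist_bound)
    fix t0 :: real
    define t where "t = clamp a b t0"
    have t: "t \<in> {a..b}"
      using clamp_in_interval[of a b t0] \<open>a \<le> b\<close> by (simp add: t_def)
    have int: "r w integrable_on {a..t}" for w :: "real \<Rightarrow>\<^sub>C 'a"
      by (rule integrable_continuous_real, rule continuous_on_subset[OF r_cont]) (use t in auto)
    \<comment> \<open>The contraction factor 1/2 arises here: \<open>E\<close> grows at rate
      \<open>2 * K\<close>, so \<open>K * E\<close> has the antiderivative
      \<open>E / 2\<close>.\<close>
    have prim: "((\<lambda>s. K * dist u v * E s) has_integral (dist u v / 2 * E t - dist u v / 2 * E a)) {a..t}"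
    proof (rule fundamental_theorem_of_calculus)
      show "((\<lambda>s. dist u v / 2 * E s) has_vector_derivative K * dist u v * E s) (at s within {a..t})" for s
        unfolding E_def has_real_derivative_iff_has_vector_derivative[symmetric]
        by (auto intro!: derivative_eq_intros)
    qed (use t in auto)
    have "norm (I u t - I v t) = norm (integral {a..t} (\<lambda>s. r u s - r v s))"
      using int by (simp add: I_def Henstock_Kurzweil_Integration.integral_diff)
    also have "\<dots> \<le> integral {a..t} (\<lambda>s. K * dist u v * E s)"
    proof (rule integral_norm_bound_integral)
      show "(\<lambda>s. r u s - r v s) integrable_on {a..t}"
        using int by (intro integrable_diff)
      show "(\<lambda>s. K * dist u v * E s) integrable_on {a..t}"
        using prim by blast
      fix s assume "s \<in> {a..t}"
      then have s: "s \<in> {a..b}" using t by auto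
      have "norm (r u s - r v s) = norm (\<Phi> s (E s *\<^sub>R (u s - v s)))"
        by (simp add: r_def linear_diff[OF lin[OF s], symmetric] scaleR_diff_right)
      also have "\<dots> \<le> K * (E s * dist (u s) (v s))"
        using K[OF s, of "E s *\<^sub>R (u s - v s)"] E_pos[of s] by (simp add: dist_norm)
      also have "\<dots> \<le> K * (E s * dist u v)"
        using E_pos[of s] \<open>0 < K\<close> by (intro mult_left_mono dist_bounded) auto
      finally show "norm (r u s - r v s) \<le> K * dist u v * E s"
        by (simp add: mult_ac)
    qed
    also have "\<dots> \<le> dist u v / 2 * E t"
      using integral_unique[OF prim] E_pos[of a] by simp
    finally have "norm (I u t - I v t) / E t \<le> 1 / 2 * dist u v"
      using E_pos[of t] by (simp add: pos_divide_le_eq)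
    moreover have "dist (P u t0) (P v t0) = norm ((1 / E t) *\<^sub>R (I u t - I v t))"
      by (simp only: P t_def[symmetric] dist_norm scaleR_diff_right)
    ultimately show "dist (P u t0) (P v t0) \<le> 1 / 2 * dist u v"
      using E_pos[of t] by simp
  qed
  then obtain u where u: "P u = u"
    using banach_fix_type[of "1/2" P] by auto
  \<comment> \<open>On \<open>{a..b}\<close> the clamp is the identity, so the fixed point equation
    says that the rescaled \<open>u\<close> equals \<open>I u\<close>. The solution returned is
    \<open>I u\<close>, whose derivative is known from its integral form.\<close>
  have uI: "E t *\<^sub>R u t = I u t" if "t \<in> {a..b}" for t
  proof -
    have "u t = (1 / E t) *\<^sub>R I u t"
      using P[of u t] that by (simp add: u clamp_cancel_cbox)
    then show ?thesis using E_pos[of t] by simp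
  qed
  show ?thesis
  proof
    show "I u a = x0" by (simp add: I_def)
    show "(I u has_vector_derivative \<Phi> t (I u t) + g t) (at t within {a..b})" if "t \<in> {a..b}" for t
      using I_der[of u t] that uI[OF that] by (simp add: r_def)
  qed
qed

text \<open>Reflecting time by \<open>t\<close> to \<open>a + b - t\<close> maps the interval onto
  itself, exchanges its ends and changes the sign of the right-hand side, which reduces the claim to
  the initial value problem.\<close>

lemma linear_ode_terminal_exists:
  fixes \<Phi> :: "real \<Rightarrow> 'a::euclidean_space \<Rightarrow> 'a"
  assumes "a \<le> b"
    and lin: "\<And>t. t \<in> {a..b} \<Longrightarrow> linear (\<Phi> t)"
    and cont: "\<And>v. continuous_on {a..b} (\<lambda>t. \<Phi> t v)"
    and g: "continuous_on {a..b} g"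
  obtains x where "x b = x1"
    "\<And>t. t \<in> {a..b} \<Longrightarrow> (x has_vector_derivative \<Phi> t (x t) + g t) (at t within {a..b})"
proof -
  have refl: "continuous_on {a..b} (\<lambda>t. w (a + b - t))" if "continuous_on {a..b} w" for w :: "real \<Rightarrow> 'a"
    by (rule continuous_on_compose2[OF that]) (auto intro!: continuous_intros)
  obtain y where y: "y a = x1" and
    yd: "\<And>t. t \<in> {a..b} \<Longrightarrow> (y has_vector_derivative - \<Phi> (a + b - t) (y t) + - g (a + b - t)) (at t within {a..b})"
  proof (rule linear_ode_initial_exists[of a b "\<lambda>t v. - \<Phi> (a + b - t) v" "\<lambda>t. - g (a + b - t)" x1])
    show "linear (\<lambda>v. - \<Phi> (a + b - t) v)" if "t \<in> {a..b}" for t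
      using that by (intro linear_compose_neg lin) auto
    show "continuous_on {a..b} (\<lambda>t. - \<Phi> (a + b - t) v)" for v
      using refl[OF cont[of v]] by (rule continuous_on_minus)
    show "continuous_on {a..b} (\<lambda>t. - g (a + b - t))"
      using refl[OF g] by (rule continuous_on_minus)
  qed (use \<open>a \<le> b\<close> in auto)
  show ?thesis
  proof (rule that[of "\<lambda>t. y (a + b - t)"])
    show "y (a + b - b) = x1" using y by simp
    fix t assume t: "t \<in> {a..b}"
    have img: "(\<lambda>t. a + b - t) ` {a..b} = {a..b}"
      by (auto simp: image_iff intro!: bexI[of _ "a + b - _"])
    have "((\<lambda>t. a + b - t) has_vector_derivative - 1) (at t within {a..b})"
      by (auto intro!: derivative_eq_intros)
    then have "((y \<circ> (\<lambda>t. a + b - t)) has_vector_derivative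
        (- 1) *\<^sub>R (- \<Phi> (a + b - (a + b - t)) (y (a + b - t)) + - g (a + b - (a + b - t)))) (at t within {a..b})"
      by (rule vector_diff_chain_within) (use yd[of "a + b - t"] t in \<open>simp add: img\<close>)
    then show "((\<lambda>t. y (a + b - t)) has_vector_derivative \<Phi> t (y (a + b - t)) + g t) (at t within {a..b})"
      by (simp add: o_def add.commute)
  qed
qed

section \<open>Matrix Riccati equations\<close>

lemma bounded_bilinear_matrix_matrix_mult:
  "bounded_bilinear ((**) :: real^'n^'m \<Rightarrow> real^'p^'n \<Rightarrow> real^'p^'m)"
  unfolding bilinear_conv_bounded_bilinear[symmetric] bilinear_def
  by (auto intro!: linearI simp: vec_eq_iff matrix_matrix_mult_def sum_distrib_left mult_ac
      sum.distrib distrib_left distrib_right)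

lemma bounded_bilinear_matrix_vector_mult:
  "bounded_bilinear ((*v) :: real^'n^'m \<Rightarrow> real^'n \<Rightarrow> real^'m)"
  unfolding bilinear_conv_bounded_bilinear[symmetric] bilinear_def
  by (auto intro!: linearI simp: vec_eq_iff matrix_vector_mult_def sum_distrib_left mult_ac
      sum.distrib distrib_left distrib_right)

lemma bounded_linear_transpose: "bounded_linear (transpose :: real^'n^'m \<Rightarrow> real^'m^'n)"
  unfolding linear_conv_bounded_linear[symmetric]
  by (auto intro!: linearI simp: transpose_def vec_eq_iff)

lemmas matrix_mult_has_vector_derivative =
  bounded_bilinear.has_vector_derivative[OF bounded_bilinear_matrix_matrix_mult]
lemmas continuous_on_matrix_mult =
  bounded_bilinear.continuous_on[OF bounded_bilinear_matrix_matrix_mult]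
lemmas continuous_on_matrix_vector_mult =
  bounded_bilinear.continuous_on[OF bounded_bilinear_matrix_vector_mult]
lemmas continuous_on_transpose = bounded_linear.continuous_on[OF bounded_linear_transpose]
lemmas matrix_mult_left_linear =
  bounded_linear.linear[OF bounded_bilinear.bounded_linear_right[OF bounded_bilinear_matrix_matrix_mult]]
lemmas matrix_mult_right_linear =
  bounded_linear.linear[OF bounded_bilinear.bounded_linear_left[OF bounded_bilinear_matrix_matrix_mult]]

lemmas matrix_bilinear_simps =
  bounded_bilinear.diff_left[OF bounded_bilinear_matrix_matrix_mult]
  bounded_bilinear.diff_right[OF bounded_bilinear_matrix_matrix_mult]
  bounded_bilinear.add_left[OF bounded_bilinear_matrix_matrix_mult]
  bounded_bilinear.add_right[OF bounded_bilinear_matrix_matrix_mult]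
  bounded_bilinear.minus_left[OF bounded_bilinear_matrix_matrix_mult]
  bounded_bilinear.minus_right[OF bounded_bilinear_matrix_matrix_mult]
  bounded_bilinear.scaleR_left[OF bounded_bilinear_matrix_matrix_mult]
  bounded_bilinear.scaleR_right[OF bounded_bilinear_matrix_matrix_mult]

section \<open>Differentiability of determinants and of matrix quotients\<close>

lemma differentiable_prod_real:
  fixes f :: "'i \<Rightarrow> 'a::real_normed_vector \<Rightarrow> real"
  assumes "\<And>i. i \<in> I \<Longrightarrow> f i differentiable (at t within S)"
  shows "(\<lambda>x. \<Prod>i\<in>I. f i x) differentiable (at t within S)"
  using assms by (induction I rule: infinite_finite_induct) auto

lemma differentiable_det:
  fixes X :: "'a::real_normed_vector \<Rightarrow> real^'n^'n"
  assumes "\<And>i j. (\<lambda>s. X s $ i $ j) differentiable (at t within S)"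
  shows "(\<lambda>s. det (X s)) differentiable (at t within S)"
  unfolding det_def
  by (intro differentiable_sum ballI differentiable_mult differentiable_prod_real differentiable_const assms)
    simp

lemma differentiable_vec_componentwise:
  fixes f :: "'a::real_normed_vector \<Rightarrow> real^'n"
  assumes "\<And>i. (\<lambda>s. f s $ i) differentiable (at t within S)"
  shows "f differentiable (at t within S)"
  by (subst differentiable_componentwise_within) (auto simp: Basis_vec_def inner_axis assms)

lemma differentiable_vec_nth:
  fixes f :: "'a::real_normed_vector \<Rightarrow> ('b::real_normed_vector)^'n"
  assumes "f differentiable (at t within S)"
  shows "(\<lambda>s. f s $ i) differentiable (at t within S)"
  using assms bounded_linear.has_derivative[OF bounded_linear_vec_nth]
  unfolding differentiable_def by blast

text \<open>Cramer's rule expresses the solution by determinants, which are differentiable.\<close>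

lemma differentiable_linear_solve:
  fixes X :: "'a::real_normed_vector \<Rightarrow> real^'n^'n" and u w :: "'a \<Rightarrow> real^'n"
  assumes X: "X differentiable (at t within S)" and w: "w differentiable (at t within S)"
    and det: "\<And>s. s \<in> S \<Longrightarrow> det (X s) \<noteq> 0"
    and eq: "\<And>s. s \<in> S \<Longrightarrow> X s *v u s = w s" and t: "t \<in> S"
  shows "u differentiable (at t within S)"
proof (rule differentiable_vec_componentwise)
  fix k
  let ?N = "\<lambda>s. det (\<chi> i j. if j = k then w s $ i else X s $ i $ j)"
  have "(\<lambda>s. ?N s / det (X s)) differentiable (at t within S)"
  proof (intro differentiable_divide differentiable_det det t)
    show "(\<lambda>s. X s $ i $ j) differentiable (at t within S)" for i j
      by (intro differentiable_vec_nth X)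
    show "(\<lambda>s. (\<chi> i j. if j = k then w s $ i else X s $ i $ j) $ i $ j) differentiable (at t within S)" for i j
      by (cases "j = k") (auto intro!: differentiable_vec_nth X w)
  qed
  then obtain D where D: "((\<lambda>s. ?N s / det (X s)) has_derivative D) (at t within S)"
    unfolding differentiable_def by blast
  have "u s $ k = ?N s / det (X s)" if "s \<in> S" for s
    using eq[OF that] cramer[OF det[OF that], of "u s" "w s"] by (simp add: vec_eq_iff)
  then have "((\<lambda>s. u s $ k) has_derivative D) (at t within S)"
    by (rule has_derivative_transform[OF t _ D])
  then show "(\<lambda>s. u s $ k) differentiable (at t within S)"
    by (rule differentiableI)
qed

text \<open>Transposing \<open>L ** X = Y\<close> turns each row of \<open>L\<close> into the
  solution of a linear system with matrix \<open>transpose (X s)\<close>, to which Cramer's rule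
  applies.\<close>

lemma differentiable_matrix_quotient:
  fixes X L Y :: "'a::real_normed_vector \<Rightarrow> real^'n^'n"
  assumes X: "X differentiable (at t within S)" and Y: "Y differentiable (at t within S)"
    and det: "\<And>s. s \<in> S \<Longrightarrow> det (X s) \<noteq> 0"
    and eq: "\<And>s. s \<in> S \<Longrightarrow> L s ** X s = Y s" and t: "t \<in> S"
  shows "L differentiable (at t within S)"
proof -
  have row: "(\<lambda>s. L s $ i) differentiable (at t within S)" for i
  proof (rule differentiable_linear_solve[where X = "\<lambda>s. transpose (X s)" and w = "\<lambda>s. Y s $ i"])
    show "(\<lambda>s. transpose (X s)) differentiable (at t within S)"
      using X bounded_linear.has_derivative[OF bounded_linear_transpose]
      unfolding differentiable_def by blast
    show "transpose (X s) *v L s $ i = Y s $ i" if "s \<in> S" for s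
      using eq[OF that]
      by (simp add: vec_eq_iff matrix_vector_mult_def matrix_matrix_mult_def transpose_def mult.commute)
    show "(\<lambda>s. Y s $ i) differentiable (at t within S)"
      by (rule differentiable_vec_nth[OF Y])
  qed (simp_all add: det t)
  show ?thesis
  proof (subst differentiable_componentwise_within, rule ballI)
    fix e :: "real^'n^'n" assume "e \<in> Basis"
    then obtain i b where e: "e = axis i b"
      unfolding Basis_vec_def by blast
    obtain D where "((\<lambda>s. L s $ i) has_derivative D) (at t within S)"
      using row[of i] unfolding differentiable_def by blast
    from bounded_linear.has_derivative[OF bounded_linear_inner_left this]
    show "(\<lambda>s. L s \<bullet> e) differentiable at t within S"
      unfolding e inner_axis by (rule differentiableI)
  qed
qed

text \<open>The quadratic terms differ by \<open>L' S L' - L S L = D S L' + L S D\<close> with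
  \<open>D = L' - L\<close>. For two given solutions \<open>D\<close> thus satisfies a linear
  equation with continuous coefficients and zero terminal value.\<close>

lemma riccati_unique:
  fixes L L' :: "real \<Rightarrow> real^'n^'n"
  assumes A: "continuous_on {a..b} A"
    and L: "\<And>t. t \<in> {a..b} \<Longrightarrow> (L has_vector_derivative
        - (L t ** A t + transpose (A t) ** L t - L t ** S ** L t + Q t)) (at t within {a..b})"
    and L': "\<And>t. t \<in> {a..b} \<Longrightarrow> (L' has_vector_derivative
        - (L' t ** A t + transpose (A t) ** L' t - L' t ** S ** L' t + Q t)) (at t within {a..b})"
    and "L b = L' b" and t: "t \<in> {a..b}"
  shows "L' t = L t"
proof -
  define \<Phi> where "\<Phi> t D = - (D ** A t + transpose (A t) ** D - (D ** (S ** L' t) + (L t ** S) ** D))" for t D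
  have "L' t - L t = 0"
  proof (rule linear_ode_zero_terminal[of a b \<Phi> "\<lambda>t. L' t - L t"])
    show "linear (\<Phi> t)" for t
      unfolding \<Phi>_def
      by (intro linear_compose_neg linear_compose_sub linear_compose_add
          matrix_mult_left_linear matrix_mult_right_linear)
    have "continuous_on {a..b} L" "continuous_on {a..b} L'"
      by (rule continuous_on_vector_derivative, erule L) (rule continuous_on_vector_derivative, erule L')
    then show "continuous_on {a..b} (\<lambda>t. \<Phi> t v)" for v
      unfolding \<Phi>_def
      by (intro continuous_intros continuous_on_matrix_mult continuous_on_transpose A)
    fix t assume t: "t \<in> {a..b}"
    show "((\<lambda>t. L' t - L t) has_vector_derivative \<Phi> t (L' t - L t)) (at t within {a..b})"
      by (rule has_vector_derivative_eq_rhs[OF has_vector_derivative_diff[OF L'[OF t] L[OF t]]])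
        (simp add: \<Phi>_def matrix_bilinear_simps matrix_mul_assoc)
  qed (use assms in auto)
  then show ?thesis by simp
qed

text \<open>Radon's linearisation: \<open>L = Y X\<^sup>-\<^sup>1\<close> for the linear Hamiltonian system in \<open>(X, Y)\<close>.
  The assumption \<open>nondeg\<close> rules out conjugate points, i.e. it makes \<open>X t\<close> invertible.\<close>

lemma riccati_exists:
  fixes A Q :: "real \<Rightarrow> real^'n^'n" and S LT :: "real^'n^'n"
  assumes "a < b" and A: "continuous_on {a..b} A" and Q: "continuous_on {a..b} Q"
    and Qsym: "\<And>t. t \<in> {a..b} \<Longrightarrow> transpose (Q t) = Q t"
    and Ssym: "transpose S = S" and LTsym: "transpose LT = LT"
    and nondeg: "\<And>t0 x y. t0 \<in> {a..b} \<Longrightarrow> x t0 = 0 \<Longrightarrow> y b = LT *v x b \<Longrightarrow>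
      (\<And>t. t \<in> {t0..b} \<Longrightarrow> (x has_vector_derivative A t *v x t - S *v y t) (at t within {t0..b})) \<Longrightarrow>
      (\<And>t. t \<in> {t0..b} \<Longrightarrow>
        (y has_vector_derivative - (Q t *v x t) - transpose (A t) *v y t) (at t within {t0..b})) \<Longrightarrow>
      x b = 0"
  obtains L where "L b = LT" "\<And>t. t \<in> {a..b} \<Longrightarrow> transpose (L t) = L t"
    "\<And>t. t \<in> {a..b} \<Longrightarrow> (L has_vector_derivative
        - (L t ** A t + transpose (A t) ** L t - L t ** S ** L t + Q t)) (at t within {a..b})"
proof -
  define \<Phi> :: "real \<Rightarrow> (real^'n^'n) \<times> (real^'n^'n) \<Rightarrow> (real^'n^'n) \<times> (real^'n^'n)"
    where "\<Phi> t Z = (A t ** fst Z - S ** snd Z, - (Q t ** fst Z) - transpose (A t) ** snd Z)" for t Z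
  obtain Z where Zb: "Z b = (mat 1, LT)" and
    Zd: "\<And>t. t \<in> {a..b} \<Longrightarrow> (Z has_vector_derivative \<Phi> t (Z t) + 0) (at t within {a..b})"
  proof (rule linear_ode_terminal_exists[of a b \<Phi> "\<lambda>_. 0" "(mat 1, LT)"])
    show "linear (\<Phi> t)" for t
      by (rule linearI) (auto simp: \<Phi>_def matrix_bilinear_simps scaleR_diff_right)
    show "continuous_on {a..b} (\<lambda>t. \<Phi> t v)" for v
      unfolding \<Phi>_def
      by (intro continuous_intros continuous_on_matrix_mult continuous_on_transpose A Q)
  qed (use \<open>a < b\<close> in auto)
  define X Y where "X t = fst (Z t)" and "Y t = snd (Z t)" for t
  have Xd: "(X has_vector_derivative A t ** X t - S ** Y t) (at t within {a..b})"
    and Yd: "(Y has_vector_derivative - (Q t ** X t) - transpose (A t) ** Y t) (at t within {a..b})"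
    if "t \<in> {a..b}" for t
    using bounded_linear.has_vector_derivative[OF bounded_linear_fst Zd[OF that]]
      bounded_linear.has_vector_derivative[OF bounded_linear_snd Zd[OF that]]
    unfolding X_def[abs_def] Y_def[abs_def] by (simp_all add: \<Phi>_def)
  have Xb: "X b = mat 1" and Yb: "Y b = LT"
    by (simp_all add: X_def Y_def Zb)
  have inv: "invertible (X t0)" if t0: "t0 \<in> {a..b}" for t0
  proof -
    have "v = 0" if "X t0 *v v = 0" for v
    proof -
      have const: "((\<lambda>s. W s *v v) has_vector_derivative W' *v v) (at t within {t0..b})"
        if "(W has_vector_derivative W') (at t within {a..b})" for W :: "real \<Rightarrow> real^'n^'n" and W' t
        using bounded_linear.has_vector_derivative
            [OF bounded_bilinear.bounded_linear_left[OF bounded_bilinear_matrix_vector_mult]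
            has_vector_derivative_within_subset[OF that, of "{t0..b}"]] t0 by auto
      \<comment> \<open>A kernel vector \<open>v\<close> of \<open>X t0\<close> gives the extremal
        \<open>(X s *v v, Y s *v v)\<close> starting from \<open>x = 0\<close>. Since
        \<open>X b\<close> is the identity, \<open>nondeg\<close> then reads
        \<open>v = 0\<close>.\<close>
      have "X b *v v = 0"
      proof (rule nondeg[of t0 "\<lambda>s. X s *v v" "\<lambda>s. Y s *v v"])
        fix t assume "t \<in> {t0..b}"
        then have t: "t \<in> {a..b}" using t0 by auto
        show "((\<lambda>s. X s *v v) has_vector_derivative A t *v (X t *v v) - S *v (Y t *v v)) (at t within {t0..b})"
          using const[OF Xd[OF t]] by (simp add: matrix_vector_mult_diff_rdistrib matrix_vector_mul_assoc)
        show "((\<lambda>s. Y s *v v) has_vector_derivative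
            - (Q t *v (X t *v v)) - transpose (A t) *v (Y t *v v)) (at t within {t0..b})"
          using const[OF Yd[OF t]]
          by (simp add: matrix_vector_mult_diff_rdistrib matrix_vector_mul_assoc
              bounded_bilinear.minus_left[OF bounded_bilinear_matrix_vector_mult])
      qed (use that t0 in \<open>auto simp: Xb Yb\<close>)
      then show "v = 0" by (simp add: Xb)
    qed
    then show ?thesis
      using invertible_left_inverse matrix_left_invertible_ker by blast
  qed
  then obtain V where XV: "\<And>t. t \<in> {a..b} \<Longrightarrow> X t ** V t = mat 1"
    and VX: "\<And>t. t \<in> {a..b} \<Longrightarrow> V t ** X t = mat 1"
    unfolding invertible_def by metis
  define L where "L t = Y t ** V t" for t
  have LX: "L t ** X t = Y t" if "t \<in> {a..b}" for t
    using VX[OF that] by (simp add: L_def matrix_mul_assoc[symmetric])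
  have Lb: "L b = LT"
    using LX[of b] \<open>a < b\<close> by (simp add: Xb Yb)
  have Ld: "(L has_vector_derivative
        - (L t ** A t + transpose (A t) ** L t - L t ** S ** L t + Q t)) (at t within {a..b})"
    if t: "t \<in> {a..b}" for t
  proof -
    \<comment> \<open>With differentiability secured first, the derivative is found by
      differentiating \<open>L ** X = Y\<close> by the product rule and cancelling
      \<open>X t\<close>; no formula for the derivative of an inverse enters.\<close>
    have "L differentiable (at t within {a..b})"
      by (rule differentiable_matrix_quotient[where X = X and Y = Y])
        (use Xd Yd inv LX t in \<open>auto intro: differentiableI_vector simp: invertible_det_nz\<close>)
    then obtain D where D: "(L has_vector_derivative D) (at t within {a..b})"
      using vector_derivative_works by blast
    have "((\<lambda>s. L s ** X s) has_vector_derivative L t ** (A t ** X t - S ** Y t) + D ** X t) (at t within {a..b})"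
      by (rule matrix_mult_has_vector_derivative[OF D Xd[OF t]])
    from has_vector_derivative_transform[OF t _ this, of Y]
    have "(Y has_vector_derivative L t ** (A t ** X t - S ** Y t) + D ** X t) (at t within {a..b})"
      by (simp add: LX)
    then have "L t ** (A t ** X t - S ** Y t) + D ** X t = - (Q t ** X t) - transpose (A t) ** Y t"
      using vector_derivative_unique_within_closed_interval[of a b t Y] Yd[OF t] t \<open>a < b\<close> by auto
    then have "D ** X t = - (Q t ** X t) - transpose (A t) ** Y t - L t ** (A t ** X t - S ** Y t)"
      by (simp add: eq_diff_eq add.commute)
    also have "\<dots> = (- (L t ** A t + transpose (A t) ** L t - L t ** S ** L t + Q t)) ** X t"
      by (simp add: matrix_bilinear_simps matrix_mul_assoc[symmetric] LX[OF t])
    finally have "D ** X t = (- (L t ** A t + transpose (A t) ** L t - L t ** S ** L t + Q t)) ** X t" .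
    then have "D ** X t ** V t =
        (- (L t ** A t + transpose (A t) ** L t - L t ** S ** L t + Q t)) ** X t ** V t"
      by simp
    then have "D = - (L t ** A t + transpose (A t) ** L t - L t ** S ** L t + Q t)"
      by (simp add: matrix_mul_assoc[symmetric] XV[OF t])
    then show ?thesis using D by simp
  qed
  \<comment> \<open>The data are symmetric, so the transpose solves the same equation with the same
    terminal value, and uniqueness identifies it with \<open>L\<close>.\<close>
  have Lsym: "transpose (L t) = L t" if t: "t \<in> {a..b}" for t
  proof (rule riccati_unique[where L' = "\<lambda>t. transpose (L t)", OF A Ld _ _ t])
    fix t assume t: "t \<in> {a..b}"
    show "((\<lambda>t. transpose (L t)) has_vector_derivative - (transpose (L t) ** A t
        + transpose (A t) ** transpose (L t) - transpose (L t) ** S ** transpose (L t) + Q t)) (at t within {a..b})"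
      by (rule has_vector_derivative_eq_rhs[OF bounded_linear.has_vector_derivative[OF bounded_linear_transpose Ld[OF t]]])
        (simp add: linear_add[OF bounded_linear.linear[OF bounded_linear_transpose]]
          linear_diff[OF bounded_linear.linear[OF bounded_linear_transpose]] linear_neg[OF bounded_linear.linear[OF bounded_linear_transpose]]
          matrix_transpose_mul Qsym[OF t] Ssym matrix_mul_assoc)
  qed (simp_all add: Lb LTsym)
  show ?thesis
    by (rule that[OF Lb Lsym Ld])
qed

section \<open>Absence of conjugate points\<close>

lemma tan_ge_self:
  fixes x :: real
  assumes "0 \<le> x" "x < pi / 2"
  shows "x \<le> tan x"
proof -
  have "arctan (tan x) \<le> tan x"
    using assms by (intro arctan_le_self tan_pos_pi2_le) auto
  then show ?thesis using assms by (simp add: arctan_tan)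
qed

text \<open>This is the comparison solution that vanishes at \<open>t1\<close>. The amplitude and
  the frequency multiply to \<open>q\<close> and have quotient \<open>1 / \<beta>\<close>; the bound
  on the argument keeps the tangent away from its poles.\<close>

lemma scaled_tan_has_real_derivative:
  fixes \<beta> q :: real
  assumes "0 < \<beta>" "0 < q" and arg: "\<bar>sqrt (\<beta> * q) * (t1 - t)\<bar> < pi / 2"
  shows "((\<lambda>t. sqrt (q / \<beta>) * tan (sqrt (\<beta> * q) * (t1 - t))) has_real_derivative
    - (\<beta> * (sqrt (q / \<beta>) * tan (sqrt (\<beta> * q) * (t1 - t)))\<^sup>2 + q)) (at t within S)"
proof -
  define \<theta> where "\<theta> = sqrt (\<beta> * q) * (t1 - t)"
  have "0 < cos \<theta>"
    using arg unfolding \<theta>_def[symmetric] by (intro cos_gt_zero_pi) linarith+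
  then have "((\<lambda>t. sqrt (q / \<beta>) * tan (sqrt (\<beta> * q) * (t1 - t))) has_real_derivative
      sqrt (q / \<beta>) * (inverse ((cos \<theta>)\<^sup>2) * - sqrt (\<beta> * q))) (at t within S)"
    unfolding \<theta>_def by (auto intro!: derivative_eq_intros)
  moreover have "inverse ((cos \<theta>)\<^sup>2) = 1 + (tan \<theta>)\<^sup>2"
    using tan_sec[of \<theta>] \<open>0 < cos \<theta>\<close> by (simp add: power_inverse)
  moreover have rw: "sqrt (q / \<beta>) * sqrt (\<beta> * q) = q"
    using assms by (simp add: real_sqrt_mult[symmetric])
  have "u * (v * - w) = - (u * w * v)" for u v w :: real
    by simp
  from this[of "sqrt (q / \<beta>)" "1 + (tan \<theta>)\<^sup>2" "sqrt (\<beta> * q)"]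
  have "sqrt (q / \<beta>) * ((1 + (tan \<theta>)\<^sup>2) * - sqrt (\<beta> * q)) = - (q * (1 + (tan \<theta>)\<^sup>2))"
    unfolding rw .
  moreover have "\<beta> * (sqrt (q / \<beta>) * tan \<theta>)\<^sup>2 + q = q * (1 + (tan \<theta>)\<^sup>2)"
    using assms by (simp add: power_mult_distrib distrib_left)
  ultimately show ?thesis
    unfolding \<theta>_def by (simp only: mult_minus_right mult_minus_left)
qed

text \<open>Completing the square in the control leaves
  \<open>- b * (y + \<phi> * x)\<^sup>2\<close>. The remaining coefficient of
  \<open>x\<^sup>2\<close> is controlled by \<open>2 * \<bar>A\<bar> * \<bar>\<phi>\<bar> \<le>
  \<bar>A\<bar> * (1 + \<phi>\<^sup>2)\<close> and
  \<open>b + \<bar>A\<bar> \<le> \<beta>\<close>.\<close>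

lemma first_multiplier_bound:
  fixes b \<beta> q A \<phi> x y :: real
  assumes "0 \<le> b" "b + \<bar>A\<bar> \<le> \<beta>"
  shows "- b * y\<^sup>2 + - (\<beta> * \<phi>\<^sup>2 + q) * x\<^sup>2 + 2 * \<phi> * x * (A * x - b * y) \<le> (\<bar>A\<bar> - q) * x\<^sup>2"
proof -
  have "A * \<phi> \<le> \<bar>A\<bar> * \<bar>\<phi>\<bar>"
    by (metis abs_ge_self abs_mult)
  moreover have "0 \<le> \<bar>A\<bar> * (1 - \<bar>\<phi>\<bar>)\<^sup>2"
    by simp
  moreover have "(b + \<bar>A\<bar>) * \<phi>\<^sup>2 \<le> \<beta> * \<phi>\<^sup>2"
    using assms by (intro mult_right_mono) auto
  ultimately have "b * \<phi>\<^sup>2 - \<beta> * \<phi>\<^sup>2 + 2 * A * \<phi> \<le> \<bar>A\<bar>"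
    by (simp add: power2_diff algebra_simps)
  then have "(b * \<phi>\<^sup>2 - \<beta> * \<phi>\<^sup>2 + 2 * A * \<phi>) * x\<^sup>2 \<le> \<bar>A\<bar> * x\<^sup>2"
    by (intro mult_right_mono) auto
  moreover have "0 \<le> b * (y + \<phi> * x)\<^sup>2"
    using assms by simp
  ultimately show ?thesis
    by (simp add: power2_eq_square algebra_simps)
qed

text \<open>With \<open>z = X - x2\<close>, whose derivative is \<open>h * x1\<close>, the left side
  is the derivative of \<open>\<psi> * z\<^sup>2\<close>. Young's inequality splits the mixed term,
  and \<open>H \<le> \<beta>\<close> absorbs the part in \<open>\<psi>\<close>.\<close>

lemma second_multiplier_bound:
  fixes h H \<beta> q p \<psi> x z :: real
  assumes "\<bar>h\<bar> \<le> H" "H \<le> \<beta>" "p \<le> q"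
  shows "- (\<beta> * \<psi>\<^sup>2 + q) * z\<^sup>2 + 2 * \<psi> * z * (h * x) \<le> H * x\<^sup>2 - p * z\<^sup>2"
proof -
  have "2 * \<psi> * z * (h * x) \<le> \<bar>h\<bar> * (2 * \<bar>\<psi> * z\<bar> * \<bar>x\<bar>)"
    using abs_ge_self[of "2 * \<psi> * z * (h * x)"] by (simp add: abs_mult mult_ac)
  also have "\<dots> \<le> H * ((\<psi> * z)\<^sup>2 + x\<^sup>2)"
    using sum_squares_bound[of "\<bar>\<psi> * z\<bar>" "\<bar>x\<bar>"] assms by (intro mult_mono) auto
  also have "\<dots> \<le> \<beta> * (\<psi> * z)\<^sup>2 + H * x\<^sup>2"
    using assms by (simp add: distrib_left mult_right_mono)
  finally show ?thesis
    using mult_right_mono[OF \<open>p \<le> q\<close>, of "z\<^sup>2"]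
    by (simp add: power_mult_distrib algebra_simps)
qed

text \<open>\<open>P\<close> is the value of the quadratic cost along the extremal, completed by two multiplier terms
  whose coefficients \<open>\<phi>\<close>, \<open>\<psi>\<close> solve \<open>\<phi>' = - (\<beta> \<phi>\<^sup>2 + q)\<close>; these exist on \<open>{0..T}\<close> exactly
  because \<open>T sqrt (\<beta> q) < pi / 2\<close>. It is nonincreasing, yet \<open>P t0 \<le> 0 \<le> P T\<close>.\<close>

lemma no_conjugate_points:
  fixes T t0 A b c g H Q \<kappa> q \<beta> :: real and h k x1 x2 x3 y1 y2 y3 :: "real \<Rightarrow> real"
  assumes t0: "t0 \<in> {0..T}"
    and nonneg: "0 \<le> b" "0 \<le> c" "0 \<le> g" and pos: "0 < H" "0 < q" "0 < \<beta>"
    and h: "\<And>t. t \<in> {0..T} \<Longrightarrow> \<bar>h t\<bar> \<le> H"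
    and k: "\<And>t. t \<in> {0..T} \<Longrightarrow> k t \<le> \<kappa>" and k_cont: "continuous_on {0..T} k"
    and q: "\<bar>A\<bar> + H - Q \<le> q" "(c + 1) * \<kappa> \<le> q"
    and \<beta>: "b + \<bar>A\<bar> \<le> \<beta>" "H \<le> \<beta>"
    and small: "sqrt (\<beta> * q) * T < pi / 2"
    and x1: "\<And>t. t \<in> {t0..T} \<Longrightarrow> (x1 has_real_derivative A * x1 t - b * y1 t) (at t within {t0..T})"
    and x2: "\<And>t. t \<in> {t0..T} \<Longrightarrow> (x2 has_real_derivative - h t * x1 t) (at t within {t0..T})"
    and x3: "\<And>t. t \<in> {t0..T} \<Longrightarrow> (x3 has_real_derivative k t * x2 t) (at t within {t0..T})"
    and y1: "\<And>t. t \<in> {t0..T} \<Longrightarrow>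
      (y1 has_real_derivative - Q * x1 t - A * y1 t + h t * y2 t) (at t within {t0..T})"
    and y2: "\<And>t. t \<in> {t0..T} \<Longrightarrow>
      (y2 has_real_derivative c * k t * x2 t - k t * y3 t) (at t within {t0..T})"
    and y3: "\<And>t. t \<in> {t0..T} \<Longrightarrow> (y3 has_real_derivative 0) (at t within {t0..T})"
    and init: "x1 t0 = 0" "x2 t0 = 0" "x3 t0 = 0"
    and final: "y1 T = g * x1 T" "y2 T = - c * integral {0..T} k * x2 T + c * x3 T" "y3 T = c * x2 T"
  shows "x1 T = 0" "x2 T = 0" "x3 T = 0"
proof -
  define w r where "w = sqrt (\<beta> * q)" and "r = sqrt (q / \<beta>)"
  define \<phi> \<psi> where "\<phi> t = r * tan (w * (T - t))" and "\<psi> t = r * tan (w * (0 - t))" for t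
  define K where "K t = integral {0..t} k" for t
  define X where "X = x2 T"
  \<comment> \<open>The weight \<open>d\<close> solves \<open>d * (c + 1) = c\<close>: the second
    multiplier then exactly cancels the indefinite term \<open>c * k * (X - x2)\<^sup>2\<close>,
    while the share \<open>1 - d > 0\<close> of \<open>H * x1\<^sup>2\<close> survives.\<close>
  define d where "d = c / (c + 1)"
  have w: "0 < w" and rw: "r * w = q" and r: "0 < r"
    using pos by (simp_all add: w_def r_def real_sqrt_mult[symmetric])
  have d: "0 \<le> d" "d * (c + 1) = c" "1 - d = 1 / (c + 1)"
    using nonneg by (simp_all add: d_def field_simps)
  have arg: "\<bar>w * (T - t)\<bar> < pi / 2" "\<bar>w * (0 - t)\<bar> < pi / 2" if "t \<in> {0..T}" for t
  proof -
    have "0 \<le> w * (T - t)" "0 \<le> w * t" using that w by auto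
    then show "\<bar>w * (T - t)\<bar> < pi / 2" "\<bar>w * (0 - t)\<bar> < pi / 2"
      using small unfolding w_def[symmetric] right_diff_distrib mult_zero_right by linarith+
  qed
  have sub: "t \<in> {0..T}" if "t \<in> {t0..T}" for t using that t0 by auto
  have \<phi>d: "(\<phi> has_real_derivative - (\<beta> * (\<phi> t)\<^sup>2 + q)) (at t within {t0..T})"
    and \<psi>d: "(\<psi> has_real_derivative - (\<beta> * (\<psi> t)\<^sup>2 + q)) (at t within {t0..T})" if "t \<in> {t0..T}" for t
    using scaled_tan_has_real_derivative[of \<beta> q T t] scaled_tan_has_real_derivative[of \<beta> q 0 t]
      arg[OF sub[OF that]] pos
    unfolding \<phi>_def[abs_def] \<psi>_def[abs_def] w_def r_def by simp_all
  have Kd: "(K has_real_derivative k t) (at t within {t0..T})" if "t \<in> {t0..T}" for t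
    unfolding K_def[abs_def] has_real_derivative_iff_has_vector_derivative
    by (rule has_vector_derivative_within_subset[OF integral_has_vector_derivative[OF k_cont sub[OF that]]])
      (use t0 in auto)
  \<comment> \<open>The scalar product of state and costate differentiates to
    \<open>- b * y1\<^sup>2 - Q * x1\<^sup>2 + c * k * x2\<^sup>2\<close>. The last two terms
    complete the square, turning \<open>x2\<^sup>2\<close> into
    \<open>(X - x2)\<^sup>2\<close>.\<close>
  define P where "P t = x1 t * y1 t + x2 t * y2 t + x3 t * y3 t + \<phi> t * (x1 t)\<^sup>2
    + d * (\<psi> t * (X - x2 t)\<^sup>2) + c * X\<^sup>2 * K t - 2 * c * X * x3 t" for t
  define D where "D t = - b * (y1 t)\<^sup>2 - Q * (x1 t)\<^sup>2 + c * k t * (x2 t)\<^sup>2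
    + (- (\<beta> * (\<phi> t)\<^sup>2 + q) * (x1 t)\<^sup>2 + 2 * \<phi> t * x1 t * (A * x1 t - b * y1 t))
    + d * (- (\<beta> * (\<psi> t)\<^sup>2 + q) * (X - x2 t)\<^sup>2 + 2 * \<psi> t * (X - x2 t) * (h t * x1 t))
    + c * X\<^sup>2 * k t - 2 * c * X * (k t * x2 t)" for t
  have Pd: "(P has_real_derivative D t) (at t within {t0..T})" if t: "t \<in> {t0..T}" for t
    unfolding P_def[abs_def] D_def
    by (rule derivative_eq_intros x1[OF t] x2[OF t] x3[OF t] y1[OF t] y2[OF t] y3[OF t]
        \<phi>d[OF t] \<psi>d[OF t] Kd[OF t] refl)+ (simp add: power2_eq_square algebra_simps)
  have D: "D t \<le> - (H / (c + 1)) * (x1 t)\<^sup>2" if t: "t \<in> {t0..T}" for t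
  proof -
    have "(c + 1) * k t \<le> q"
      using mult_left_mono[OF k[OF sub[OF t]], of "c + 1"] nonneg q by linarith
    from mult_left_mono[OF second_multiplier_bound[OF h[OF sub[OF t]] \<beta>(2) this, of "\<psi> t" "X - x2 t" "x1 t"] d(1)]
    have "d * (- (\<beta> * (\<psi> t)\<^sup>2 + q) * (X - x2 t)\<^sup>2 + 2 * \<psi> t * (X - x2 t) * (h t * x1 t))
        \<le> d * H * (x1 t)\<^sup>2 - d * (c + 1) * k t * (X - x2 t)\<^sup>2"
      by (simp add: algebra_simps)
    moreover have "(\<bar>A\<bar> - q) * (x1 t)\<^sup>2 \<le> (Q - H) * (x1 t)\<^sup>2"
      using q by (intro mult_right_mono) auto
    ultimately have "D t \<le> (Q - H) * (x1 t)\<^sup>2 - Q * (x1 t)\<^sup>2 + c * k t * (x2 t)\<^sup>2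
        + (d * H * (x1 t)\<^sup>2 - c * k t * (X - x2 t)\<^sup>2) + c * X\<^sup>2 * k t - 2 * c * X * (k t * x2 t)"
      using first_multiplier_bound[OF nonneg(1) \<beta>(1), of "y1 t" "\<phi> t" q "x1 t"]
      unfolding D_def d(2) by linarith
    also have "\<dots> = - ((1 - d) * H) * (x1 t)\<^sup>2"
      by (simp add: power2_eq_square algebra_simps)
    finally show ?thesis by (simp add: d(3))
  qed
  have D0: "D t \<le> 0" if "t \<in> {t0..T}" for t
    using D[OF that] pos nonneg by (smt (verit) divide_nonneg_nonneg mult_nonneg_nonneg zero_le_power2 mult_minus_left)
  have mono: "P u \<ge> P v" if "t0 \<le> u" "u \<le> v" "v \<le> T" for u v
  proof -
    have "- P u \<le> - P v"
    proof (rule has_real_derivative_nonneg_imp_le[where f = "\<lambda>t. - P t" and f' = "\<lambda>t. - D t"])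
      fix t assume "t \<in> {u..v}"
      then have t: "t \<in> {t0..T}" using that by auto
      show "((\<lambda>t. - P t) has_real_derivative - D t) (at t within {u..v})"
        by (rule DERIV_minus, rule DERIV_subset[OF Pd[OF t]]) (use that in auto)
      show "0 \<le> - D t" using D0[OF t] by simp
    qed fact
    then show ?thesis by simp
  qed
  \<comment> \<open>At \<open>T\<close> both multiplier terms vanish, as \<open>\<phi> T = 0\<close>
    and \<open>x2 T = X\<close>, and the terms in \<open>K\<close> and \<open>x3\<close> cancel the
    indefinite block of the terminal condition.\<close>
  have "P T = g * (x1 T)\<^sup>2"
    by (simp add: P_def final X_def \<phi>_def K_def power2_eq_square algebra_simps)
  then have PT: "0 \<le> P T" using nonneg by simp
  \<comment> \<open>At \<open>t0\<close> the positive term \<open>c * X\<^sup>2 * K t0\<close>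
    remains, since the terminal condition integrates \<open>k\<close> from 0. This is why
    \<open>\<psi>\<close> has its zero at 0: the value \<open>- r * tan (w * t0)\<close> is at most
    \<open>- q * t0\<close>, enough to absorb it.\<close>
  have "K t0 \<le> integral {0..t0} (\<lambda>_. \<kappa>)"
    unfolding K_def using k t0
    by (intro integral_le integrable_continuous_real continuous_on_subset[OF k_cont]) auto
  then have "K t0 \<le> \<kappa> * t0" using t0 by (simp add: mult.commute)
  then have "c * K t0 \<le> d * ((c + 1) * \<kappa> * t0)"
    using mult_left_mono[of "K t0" "\<kappa> * t0" c] nonneg d(2) by (simp add: mult.assoc[symmetric])
  also have "\<dots> \<le> d * (q * t0)"
    using q t0 d by (intro mult_left_mono mult_right_mono) auto
  also have "q * t0 \<le> r * tan (w * t0)"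
    using tan_ge_self[of "w * t0"] arg(2)[OF t0] t0 w r
    by (simp add: rw[symmetric] mult.assoc)
  finally have "c * K t0 \<le> d * (r * tan (w * t0))"
    using d(1) by (simp add: mult_left_mono)
  then have "(c * K t0 - d * (r * tan (w * t0))) * X\<^sup>2 \<le> 0"
    by (simp add: mult_le_0_iff)
  moreover have "P t0 = (c * K t0 - d * (r * tan (w * t0))) * X\<^sup>2"
    by (simp add: P_def init \<psi>_def algebra_simps)
  ultimately have Pt0: "P t0 \<le> 0" by simp
  have P0: "P t = 0" if "t \<in> {t0..T}" for t
    using mono[of t0 t] mono[of t T] that PT Pt0 by auto
  have x1_zero: "x1 t = 0" if t: "t \<in> {t0..T}" for t
  \<comment> \<open>On a one-point interval the derivative is not unique, so \<open>D t = 0\<close>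
    cannot be concluded from \<open>P = 0\<close>; the initial value settles that case.\<close>
  proof (cases "t0 = T")
    case True
    then show ?thesis using t init by simp
  next
    case False
    then have "t0 < T" using t by auto
    have "(P has_real_derivative 0) (at t within {t0..T})"
      using has_vector_derivative_transform[OF t _ has_vector_derivative_const[of 0], of P] P0
      by (simp add: has_real_derivative_iff_has_vector_derivative)
    then have "D t = 0"
      using vector_derivative_unique_within_closed_interval[of t0 T t P 0 "D t"] Pd[OF t] t \<open>t0 < T\<close>
      by (simp add: has_real_derivative_iff_has_vector_derivative)
    then have "H / (c + 1) * (x1 t)\<^sup>2 \<le> 0" using D[OF t] by simp
    then show ?thesis using pos nonneg by (simp add: mult_le_0_iff divide_le_0_iff)
  qed
  have const: "f t = 0" if "f t0 = 0" and f: "\<And>t. t \<in> {t0..T} \<Longrightarrow> (f has_real_derivative 0) (at t within {t0..T})"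
    and "t \<in> {t0..T}" for f :: "real \<Rightarrow> real" and t
    using has_field_derivative_zero_constant[of "{t0..T}" f] that by force
  have x2_zero: "x2 t = 0" if "t \<in> {t0..T}" for t
    by (rule const) (use init x2 x1_zero that in \<open>force+\<close>)
  have x3_zero: "x3 t = 0" if "t \<in> {t0..T}" for t
    by (rule const) (use init x3 x2_zero that in \<open>force+\<close>)
  show "x1 T = 0" "x2 T = 0" "x3 T = 0"
    using x1_zero x2_zero x3_zero t0 by auto
qed

section \<open>The coupled system\<close>

text \<open>The system is triangular: the Riccati equation determines \<open>L\<close> alone, and
  \<open>M\<close> then solves a linear equation with coefficients built from \<open>L\<close>.
  Uniqueness follows the same order, so any two candidates for \<open>M\<close> share one linear
  equation.\<close>

lemma is_sol_exists_unique:
  fixes A Q :: "real \<Rightarrow> real^3^3" and LT :: "real^3^3"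
  assumes "0 < T" and A: "continuous_on {0..T} A" and Q: "continuous_on {0..T} Q"
    and G: "continuous_on {0..T} G"
    and Qsym: "\<And>t. t \<in> {0..T} \<Longrightarrow> transpose (Q t) = Q t" and LTsym: "transpose LT = LT"
    and nondeg: "\<And>t0 x y. t0 \<in> {0..T} \<Longrightarrow> x t0 = 0 \<Longrightarrow> y T = LT *v x T \<Longrightarrow>
      (\<And>t. t \<in> {t0..T} \<Longrightarrow>
        (x has_vector_derivative A t *v x t - ((2 / R) *\<^sub>R outer B B) *v y t) (at t within {t0..T})) \<Longrightarrow>
      (\<And>t. t \<in> {t0..T} \<Longrightarrow>
        (y has_vector_derivative - (Q t *v x t) - transpose (A t) *v y t) (at t within {t0..T})) \<Longrightarrow>
      x T = 0"
  shows "\<exists>L M. is_sol T A B R Q G LT MT L M \<and>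
    (\<forall>L' M'. is_sol T A B R Q G LT MT L' M' \<longrightarrow> (\<forall>t\<in>{0..T}. L' t = L t \<and> M' t = M t))"
proof -
  define S where "S = (2 / R) *\<^sub>R outer B B"
  have outer: "(2 / R) *\<^sub>R (L ** outer B B ** L) = L ** S ** L" for L :: "real^3^3"
    by (simp add: S_def matrix_bilinear_simps)
  have Ssym: "transpose S = S"
    by (simp add: S_def transpose_def outer_def vec_eq_iff mult.commute)
  obtain L where LT: "L T = LT" and Lsym: "\<And>t. t \<in> {0..T} \<Longrightarrow> transpose (L t) = L t"
    and Ld: "\<And>t. t \<in> {0..T} \<Longrightarrow> (L has_vector_derivative
      - (L t ** A t + transpose (A t) ** L t - L t ** S ** L t + Q t)) (at t within {0..T})"
  proof (rule riccati_exists[where S = S, OF \<open>0 < T\<close> A Q Qsym Ssym LTsym])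
    show "x T = 0"
      if "t0 \<in> {0..T}" "x t0 = 0" "y T = LT *v x T"
        "\<And>t. t \<in> {t0..T} \<Longrightarrow> (x has_vector_derivative A t *v x t - S *v y t) (at t within {t0..T})"
        "\<And>t. t \<in> {t0..T} \<Longrightarrow>
          (y has_vector_derivative - (Q t *v x t) - transpose (A t) *v y t) (at t within {t0..T})" for t0 x y
      by (rule nondeg[OF that[unfolded S_def]])
  qed (assumption, rule that)
  have L: "continuous_on {0..T} L"
    by (rule continuous_on_vector_derivative, erule Ld)
  define \<Phi> where "\<Phi> t v = - (transpose (A t) *v v - (2 / R) *\<^sub>R ((L t ** outer B B) *v v))" for t v
  have lin: "linear (\<Phi> t)" for t
    unfolding \<Phi>_def
    by (intro linear_compose_neg linear_compose_sub linear_compose_scale_right matrix_vector_mul_linear)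
  have cont: "continuous_on {0..T} (\<lambda>t. \<Phi> t v)" for v
    unfolding \<Phi>_def
    by (intro continuous_intros continuous_on_matrix_mult continuous_on_matrix_vector_mult
        continuous_on_transpose A L)
  obtain M where MT: "M T = MT"
    and Md: "\<And>t. t \<in> {0..T} \<Longrightarrow> (M has_vector_derivative \<Phi> t (M t) + G t) (at t within {0..T})"
    using linear_ode_terminal_exists[OF less_imp_le[OF \<open>0 < T\<close>] lin cont G] by blast
  have M_rhs: "\<Phi> t v + G t = - (transpose (A t) *v v - (2 / R) *\<^sub>R ((L t ** outer B B) *v v) - G t)" for t v
    by (simp add: \<Phi>_def)
  have sol: "is_sol T A B R Q G LT MT L M"
    unfolding is_sol_def outer using Lsym Ld Md LT MT unfolding M_rhs by blast
  have "\<forall>t\<in>{0..T}. L' t = L t \<and> M' t = M t" if sol': "is_sol T A B R Q G LT MT L' M'" for L' M'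
  proof -
    have L'd: "(L' has_vector_derivative
        - (L' t ** A t + transpose (A t) ** L' t - L' t ** S ** L' t + Q t)) (at t within {0..T})"
      if "t \<in> {0..T}" for t
      using sol' that unfolding is_sol_def outer by blast
    have L': "L' t = L t" if "t \<in> {0..T}" for t
      by (rule riccati_unique[OF A Ld L'd _ that]) (use sol' LT in \<open>auto simp: is_sol_def\<close>)
    have M'd: "(M' has_vector_derivative \<Phi> t (M' t) + G t) (at t within {0..T})" if "t \<in> {0..T}" for t
      using sol' that unfolding is_sol_def M_rhs L'[OF that, symmetric] by blast
    have "M' t - M t = 0" if "t \<in> {0..T}" for t
    proof (rule linear_ode_zero_terminal[where x = "\<lambda>t. M' t - M t", OF lin cont _ _ that])
      fix t assume t: "t \<in> {0..T}"
      show "((\<lambda>t. M' t - M t) has_vector_derivative \<Phi> t (M' t - M t)) (at t within {0..T})"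
        by (rule has_vector_derivative_eq_rhs[OF has_vector_derivative_diff[OF M'd[OF t] Md[OF t]]])
          (simp add: linear_diff[OF lin])
    qed (use sol' MT in \<open>auto simp: is_sol_def\<close>)
    then show ?thesis using L' by simp
  qed
  then show ?thesis using sol by blast
qed

section \<open>Bounds, continuity and coordinates of the concrete coefficients\<close>

lemma abs_le_supnorm:
  assumes "continuous_on {0..T} g" "t \<in> {0..T}"
  shows "\<bar>g t\<bar> \<le> supnorm T g"
  unfolding supnorm_def
proof (rule cSUP_upper[OF assms(2)])
  have "compact ((\<lambda>t. \<bar>g t\<bar>) ` {0..T})"
    by (intro compact_continuous_image continuous_intros assms) simp
  then show "bdd_above ((\<lambda>t. \<bar>g t\<bar>) ` {0..T})"
    by (intro bounded_imp_bdd_above compact_imp_bounded)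
qed

lemma continuous_on_matrix_entries:
  fixes A :: "'a::topological_space \<Rightarrow> real^'n^'m"
  assumes "\<And>i j. continuous_on S (\<lambda>t. A t $ i $ j)"
  shows "continuous_on S A"
proof -
  have "continuous_on S (\<lambda>t. \<chi> i j. A t $ i $ j)"
    by (intro continuous_on_vec_lambda assms)
  then show ?thesis by (simp add: vec_lambda_eta)
qed

lemma calA_continuous:
  assumes "continuous_on S h" "continuous_on S k"
  shows "continuous_on S (calA A_L h k)"
proof (rule continuous_on_matrix_entries)
  fix i j :: 3
  show "continuous_on S (\<lambda>t. calA A_L h k t $ i $ j)"
    using exhaust_3[of i] exhaust_3[of j] assms
    by (elim disjE) (simp_all add: calA_def continuous_on_minus)
qed

lemma calQ_continuous:
  assumes "continuous_on S k"
  shows "continuous_on S (calQ Q_L c k)"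
proof (rule continuous_on_matrix_entries)
  fix i j :: 3
  show "continuous_on S (\<lambda>t. calQ Q_L c k t $ i $ j)"
    using exhaust_3[of i] exhaust_3[of j] assms
    by (elim disjE) (simp_all add: calQ_def continuous_on_minus continuous_on_mult_left)
qed

lemma has_vector_derivative_nth:
  fixes x :: "real \<Rightarrow> real^'n"
  assumes "(x has_vector_derivative v) F"
  shows "((\<lambda>s. x s $ i) has_real_derivative v $ i) F"
  using bounded_linear.has_vector_derivative[OF bounded_linear_vec_nth assms]
  by (simp add: has_real_derivative_iff_has_vector_derivative)

text \<open>Written in coordinates, the Hamiltonian system becomes the six scalar equations of
  \<open>no_conjugate_points\<close>, with control weight \<open>b = 2 / R_L * B_L\<^sup>2\<close>,
  running weight \<open>Q = Q_L / 2\<close> and terminal weight \<open>g = Q_LT / 2\<close>.\<close>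

lemma hamiltonian_nondegenerate:
  fixes T A_L B_L R_L Q_L c Q_LT \<beta> q :: real and h k :: "real \<Rightarrow> real" and x y :: "real \<Rightarrow> real^3"
  defines "\<A> \<equiv> calA A_L h k"
  assumes t0: "t0 \<in> {0..T}" and "0 < R_L" "0 \<le> Q_LT" "0 \<le> c" and pos: "0 < H" "0 < q" "0 < \<beta>"
    and h: "\<And>t. t \<in> {0..T} \<Longrightarrow> \<bar>h t\<bar> \<le> H"
    and k: "\<And>t. t \<in> {0..T} \<Longrightarrow> k t \<le> \<kappa>" and k_cont: "continuous_on {0..T} k"
    and q: "\<bar>A_L\<bar> + H - Q_L / 2 \<le> q" "(c + 1) * \<kappa> \<le> q"
    and \<beta>: "2 / R_L * B_L\<^sup>2 + \<bar>A_L\<bar> \<le> \<beta>" "H \<le> \<beta>"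
    and small: "sqrt (\<beta> * q) * T < pi / 2"
    and init: "x t0 = 0" and final: "y T = L_term T Q_LT c k *v x T"
    and x: "\<And>t. t \<in> {t0..T} \<Longrightarrow> (x has_vector_derivative
      \<A> t *v x t - ((2 / R_L) *\<^sub>R outer (B_L *\<^sub>R e1) (B_L *\<^sub>R e1)) *v y t) (at t within {t0..T})"
    and y: "\<And>t. t \<in> {t0..T} \<Longrightarrow> (y has_vector_derivative
      - (calQ Q_L c k t *v x t) - transpose (\<A> t) *v y t) (at t within {t0..T})"
  shows "x T = 0"
proof -
  have S: "((2 / R_L) *\<^sub>R outer (B_L *\<^sub>R e1) (B_L *\<^sub>R e1)) *v v = vector [2 / R_L * B_L\<^sup>2 * v $ 1, 0, 0]" for v
    by (simp add: vec_eq_iff forall_3 matrix_vector_mult_def sum_3 outer_def e1_def power2_eq_square)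
  have A: "\<A> t *v v = vector [A_L * v $ 1, - h t * v $ 1, k t * v $ 2]" for t v
    by (simp add: vec_eq_iff forall_3 matrix_vector_mult_def sum_3 \<A>_def calA_def)
  have At: "transpose (\<A> t) *v v = vector [A_L * v $ 1 - h t * v $ 2, k t * v $ 3, 0]" for t v
    by (simp add: vec_eq_iff forall_3 matrix_vector_mult_def sum_3 \<A>_def calA_def transpose_def)
  have Q: "calQ Q_L c k t *v v = vector [Q_L / 2 * v $ 1, - c * k t * v $ 2, 0]" for t v
    by (simp add: vec_eq_iff forall_3 matrix_vector_mult_def sum_3 calQ_def)
  have LT: "L_term T Q_LT c k *v v
      = vector [Q_LT / 2 * v $ 1, - c * integral {0..T} k * v $ 2 + c * v $ 3, c * v $ 2]" for v
    by (simp add: vec_eq_iff forall_3 matrix_vector_mult_def sum_3 L_term_def)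
  note xd = has_vector_derivative_nth[OF x, unfolded A S]
  note yd = has_vector_derivative_nth[OF y, unfolded At Q]
  have *: "x T $ 1 = 0 \<and> x T $ 2 = 0 \<and> x T $ 3 = 0"
    using no_conjugate_points[where ?t0.0 = t0 and T = T and A = A_L and b = "2 / R_L * B_L\<^sup>2" and c = c
        and g = "Q_LT / 2" and H = H and Q = "Q_L / 2" and \<kappa> = \<kappa> and q = q and \<beta> = \<beta> and h = h and k = k
        and ?x1.0 = "\<lambda>t. x t $ 1" and ?x2.0 = "\<lambda>t. x t $ 2" and ?x3.0 = "\<lambda>t. x t $ 3"
        and ?y1.0 = "\<lambda>t. y t $ 1" and ?y2.0 = "\<lambda>t. y t $ 2" and ?y3.0 = "\<lambda>t. y t $ 3",
        OF t0 _ \<open>0 \<le> c\<close> _ pos h k k_cont q \<beta> small]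
      xd[where i = 1] xd[where i = 2] xd[where i = 3] yd[where i = 1] yd[where i = 2] yd[where i = 3]
      \<open>0 < R_L\<close> \<open>0 \<le> Q_LT\<close>
    by (simp add: init final LT algebra_simps)
  then show ?thesis by (simp add: vec_eq_iff forall_3)
qed

theorem theorem3p4:
  fixes T A_F B_F A_L B_L sigma_F sigma_L Q_F R_F Q_L R_L Q_LT lambda_L :: real
    and F a :: "real \<Rightarrow> real"
  assumes T_pos: "T > 0"
    and B_F_nz: "B_F \<noteq> 0"
    and pos: "sigma_F > 0" "sigma_L > 0" "Q_F > 0" "R_F > 0" "Q_L > 0" "R_L > 0" "Q_LT > 0"
    and lam: "lambda_L \<ge> 0"
    and F_cont: "continuous_on {0..T} F"
    and a_ode: "\<And>t. t \<in> {0..T} \<Longrightarrow>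
        (a has_real_derivative (2 * B_F\<^sup>2 / R_F * (a t)\<^sup>2 - 2 * A_F * a t - Q_F / 2)) (at t within {0..T})"
    and a_T: "a T = 0"
    and T_small: "T < 1 / sqrt (
          max (max (2 / R_L * B_L\<^sup>2 + \<bar>A_L\<bar>) (supnorm T (h_fun Q_F A_F B_F R_F a))) (supnorm T (k_fun A_F B_F R_F a))
        * max \<bar>Q_L / 2 - \<bar>A_L\<bar> - supnorm T (h_fun Q_F A_F B_F R_F a)\<bar>
              ((B_F ^ 4 * lambda_L / (sigma_F\<^sup>2 * R_F\<^sup>2) + 1) * supnorm T (k_fun A_F B_F R_F a)))
      * arctan (sqrt (
          max \<bar>Q_L / 2 - \<bar>A_L\<bar> - supnorm T (h_fun Q_F A_F B_F R_F a)\<bar>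
              ((B_F ^ 4 * lambda_L / (sigma_F\<^sup>2 * R_F\<^sup>2) + 1) * supnorm T (k_fun A_F B_F R_F a))
        / max (max (2 / R_L * B_L\<^sup>2 + \<bar>A_L\<bar>) (supnorm T (h_fun Q_F A_F B_F R_F a))) (supnorm T (k_fun A_F B_F R_F a)))
        * (1 / max (Q_LT / 2) (B_F ^ 4 * lambda_L / (sigma_F\<^sup>2 * R_F\<^sup>2) * (l1norm T (k_fun A_F B_F R_F a) + 1))))"
  shows "\<exists>L M. is_sol T (calA A_L (h_fun Q_F A_F B_F R_F a) (k_fun A_F B_F R_F a)) (B_L *\<^sub>R e1) R_L
                 (calQ Q_L (B_F ^ 4 * lambda_L / (sigma_F\<^sup>2 * R_F\<^sup>2)) (k_fun A_F B_F R_F a))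
                 (\<lambda>t. (Q_L * F t) *\<^sub>R e1)
                 (L_term T Q_LT (B_F ^ 4 * lambda_L / (sigma_F\<^sup>2 * R_F\<^sup>2)) (k_fun A_F B_F R_F a))
                 ((- (Q_LT * F T)) *\<^sub>R e1) L M \<and>
          (\<forall>L' M'. is_sol T (calA A_L (h_fun Q_F A_F B_F R_F a) (k_fun A_F B_F R_F a)) (B_L *\<^sub>R e1) R_L
                 (calQ Q_L (B_F ^ 4 * lambda_L / (sigma_F\<^sup>2 * R_F\<^sup>2)) (k_fun A_F B_F R_F a))
                 (\<lambda>t. (Q_L * F t) *\<^sub>R e1)
                 (L_term T Q_LT (B_F ^ 4 * lambda_L / (sigma_F\<^sup>2 * R_F\<^sup>2)) (k_fun A_F B_F R_F a))
                 ((- (Q_LT * F T)) *\<^sub>R e1) L' M' \<longrightarrow>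
             (\<forall>t\<in>{0..T}. L' t = L t \<and> M' t = M t))"
proof -
  define h k where "h = h_fun Q_F A_F B_F R_F a" and "k = k_fun A_F B_F R_F a"
  define c where "c = B_F ^ 4 * lambda_L / (sigma_F\<^sup>2 * R_F\<^sup>2)"
  define H \<kappa> where "H = supnorm T h" and "\<kappa> = supnorm T k"
  define q where "q = max \<bar>Q_L / 2 - \<bar>A_L\<bar> - H\<bar> ((c + 1) * \<kappa>)"
  define \<beta> where "\<beta> = max (max (2 / R_L * B_L\<^sup>2 + \<bar>A_L\<bar>) H) \<kappa>"
  define z where "z = sqrt (q / \<beta>) * (1 / max (Q_LT / 2) (c * (l1norm T k + 1)))"
  note defs = h_def[symmetric] k_def[symmetric] c_def[symmetric] H_def[symmetric] \<kappa>_def[symmetric]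
    q_def[symmetric] \<beta>_def[symmetric] z_def[symmetric]
  have small: "T < 1 / sqrt (\<beta> * q) * arctan z"
    using T_small unfolding defs .
  have "continuous_on {0..T} a"
    by (rule DERIV_continuous_on) (rule a_ode)
  then have "continuous_on {0..T} (f_fun A_F B_F R_F a)"
    unfolding f_fun_def by (intro continuous_intros)
  then have "continuous_on {0..T} (\<lambda>t. integral {0..t} (f_fun A_F B_F R_F a))"
    by (intro indefinite_integral_continuous_1 integrable_continuous_real)
  then have h_cont: "continuous_on {0..T} h" and k_cont: "continuous_on {0..T} k"
    unfolding h_def k_def h_fun_def k_fun_def by (intro continuous_intros; assumption)+
  have c: "0 \<le> c"
    using lam by (simp add: c_def)
  \<comment> \<open>The values at time 0 already make both sup norms positive, hence also
    \<open>q\<close> and \<open>\<beta>\<close>, so the quotients and roots in the smallness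
    condition are genuine.\<close>
  have "0 < h 0" "0 < k 0"
    using pos by (simp_all add: h_def k_def h_fun_def k_fun_def)
  then have H: "0 < H" and \<kappa>: "0 < \<kappa>"
    using abs_le_supnorm[OF h_cont, of 0] abs_le_supnorm[OF k_cont, of 0] T_pos
    by (simp_all add: H_def \<kappa>_def)
  have q: "0 < q" "\<bar>A_L\<bar> + H - Q_L / 2 \<le> q" "(c + 1) * \<kappa> \<le> q"
    using c \<kappa> by (auto simp: q_def less_max_iff_disj)
  have \<beta>: "0 < \<beta>" "2 / R_L * B_L\<^sup>2 + \<bar>A_L\<bar> \<le> \<beta>" "H \<le> \<beta>"
    using H by (auto simp: \<beta>_def less_max_iff_disj)
  have "0 < sqrt (\<beta> * q)" using q \<beta> by simp
  then have "sqrt (\<beta> * q) * T < arctan z"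
    using small by (simp add: field_simps)
  \<comment> \<open>Since an arctangent stays below \<open>pi / 2\<close>, the time bound keeps the
    arguments of both tangent multipliers short of the first pole.\<close>
  then have T: "sqrt (\<beta> * q) * T < pi / 2"
    using arctan_ubound[of z] by linarith
  show ?thesis
    unfolding defs
  proof (rule is_sol_exists_unique[OF T_pos])
    show "continuous_on {0..T} (calA A_L h k)"
      by (rule calA_continuous[OF h_cont k_cont])
    show "continuous_on {0..T} (calQ Q_L c k)"
      by (rule calQ_continuous[OF k_cont])
    show "continuous_on {0..T} (\<lambda>t. (Q_L * F t) *\<^sub>R e1)"
      by (intro continuous_intros F_cont)
    show "transpose (calQ Q_L c k t) = calQ Q_L c k t" for t
      by (simp add: vec_eq_iff forall_3 transpose_def calQ_def)
    show "transpose (L_term T Q_LT c k) = L_term T Q_LT c k"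
      by (simp add: vec_eq_iff forall_3 transpose_def L_term_def)
    show "x T = 0"
      if "t0 \<in> {0..T}" "x t0 = 0" "y T = L_term T Q_LT c k *v x T"
        "\<And>t. t \<in> {t0..T} \<Longrightarrow> (x has_vector_derivative
          calA A_L h k t *v x t - ((2 / R_L) *\<^sub>R outer (B_L *\<^sub>R e1) (B_L *\<^sub>R e1)) *v y t) (at t within {t0..T})"
        "\<And>t. t \<in> {t0..T} \<Longrightarrow> (y has_vector_derivative
          - (calQ Q_L c k t *v x t) - transpose (calA A_L h k t) *v y t) (at t within {t0..T})" for t0 x y
    proof (rule hamiltonian_nondegenerate[where x = x and y = y and ?t0.0 = t0, OF that(1) pos(6) _ c H q(1) \<beta>(1) _ _ k_cont q(2,3) \<beta>(2,3) T that(2,3)])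
      show "\<bar>h t\<bar> \<le> H" "k t \<le> \<kappa>" if "t \<in> {0..T}" for t
        using abs_le_supnorm[OF h_cont that] abs_le_supnorm[OF k_cont that] by (simp_all add: H_def \<kappa>_def)
    qed (use pos that in auto)
  qed
qed

end
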